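(* Let $p$ be a positive integer and $q\in(0,1)$. Let $\psi_{p,q}(x)=\frac{d}{dx}\log\Gamma_{p,q}(x)$ for $x>0$. (a) For all $x>0$, $$\psi_{p,q}(x)=\ln[p]_q+\log q\sum_{k=0}^{p}\frac{q^{x+k}}{1-q^{x+k}}$$ and $$\psi_{p,q}(x)=\ln[p]_q-\int_0^\infty\frac{e^{-xt}}{1-e^{-t}}\bigl(1-e^{-(p+1)t}\bigr)\,d\gamma_q(t),$$ where $\gamma_q$ is the discrete measure with positive masses $-\log q$ at the positive points $-k\log q$, $k=1,2,\ldots$, i.e. $\gamma_q=-\log q\sum_{k=1}^{\infty}\delta_{-k\log q}$. (b) The function $\psi_{p,q}$ is increasing on $(0,\infty)$. (c) The function $\psi_{p,q}'$ is strictly completely monotonic on $(0,\infty)$.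
   Context: For $q\in(0,1)$ and real $x$, $[x]_q=\frac{1-q^x}{1-q}$, and for a positive integer $p$, $[p]_q!=[1]_q[2]_q\cdots[p]_q$. For $x>0$, $\Gamma_{p,q}(x)=\frac{[p]_q^{x}\,[p]_q!}{[x]_q[x+1]_q\cdots[x+p]_q}$. Both $\log$ and $\ln$ denote the natural logarithm, and $\delta_a$ denotes the unit point mass at $a$. A function $f$ is strictly completely monotonic on an open interval $I$ if it has derivatives of all orders on $I$ and $(-1)^n f^{(n)}(x)>0$ for all $x\in I$ and all $n=0,1,2,\ldots$. *)

theory Defs
  imports "HOL-Probability.Probability"
begin

definition q_number :: "real \<Rightarrow> real \<Rightarrow> real" where
  "q_number q x = (1 - q powr x) / (1 - q)"

definition q_fact :: "real \<Rightarrow> nat \<Rightarrow> real" where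
  "q_fact q p = (\<Prod>k=1..p. q_number q (real k))"

definition Gamma_pq :: "nat \<Rightarrow> real \<Rightarrow> real \<Rightarrow> real" where
  "Gamma_pq p q x =
     q_number q (real p) powr x * q_fact q p / (\<Prod>k=0..p. q_number q (x + real k))"

definition psi_pq :: "nat \<Rightarrow> real \<Rightarrow> real \<Rightarrow> real" where
  "psi_pq p q x = deriv (\<lambda>y. ln (Gamma_pq p q y)) x"

text \<open>The \<open>k\<close>-th summand below (counted from \<open>0\<close>) is the unit mass at \<open>- (k + 1) ln q\<close>.
  The lemma \<open>emeasure_gamma_q\<close> shows that the set function is indeed a measure, so that
  \<^const>\<open>measure_of\<close> does not collapse to the zero measure.\<close>

definition gamma_q :: "real \<Rightarrow> real measure" where
  "gamma_q q = measure_of UNIV (sets borel)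
     (\<lambda>A. ennreal (- ln q) * (\<Sum>k. emeasure (return borel (- real (Suc k) * ln q)) A))"

lemma space_gamma_q [simp]: "space (gamma_q q) = UNIV"
  by (simp add: gamma_q_def space_measure_of_conv)

lemma sets_gamma_q [simp, measurable_cong]: "sets (gamma_q q) = sets borel"
  unfolding gamma_q_def
  by (metis sets.sets_measure_of_eq space_borel)

lemma emeasure_gamma_q:
  assumes "A \<in> sets borel"
  shows "emeasure (gamma_q q) A =
    ennreal (- ln q) * (\<Sum>k. emeasure (return borel (- real (Suc k) * ln q)) A)"
proof (rule emeasure_measure_of[OF gamma_q_def])
  show "sets borel \<subseteq> Pow (UNIV :: real set)" by simp
  show "A \<in> sets (gamma_q q)" using assms by simp
  show "positive (sets (gamma_q q))
     (\<lambda>A. ennreal (- ln q) * (\<Sum>k. emeasure (return borel (- real (Suc k) * ln q)) A))"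
    by (simp add: positive_def)
  show "countably_additive (sets (gamma_q q))
     (\<lambda>A. ennreal (- ln q) * (\<Sum>k. emeasure (return borel (- real (Suc k) * ln q)) A))"
  proof (rule countably_additiveI)
    fix F :: "nat \<Rightarrow> real set"
    assume F: "range F \<subseteq> sets (gamma_q q)" "disjoint_family F"
    have "(\<Sum>i. \<Sum>k. emeasure (return borel (- real (Suc k) * ln q)) (F i)) =
          (\<Sum>k. \<Sum>i. emeasure (return borel (- real (Suc k) * ln q)) (F i))"
      unfolding nn_integral_count_space_nat[symmetric]
      by (rule pair_sigma_finite.Fubini')
        (auto simp: pair_sigma_finite_def sigma_finite_measure_count_space)
    also have "\<dots> = (\<Sum>k. emeasure (return borel (- real (Suc k) * ln q)) (\<Union>i. F i))"
      by (intro suminf_cong suminf_emeasure) (use F in auto)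
    finally show "(\<Sum>i. ennreal (- ln q) *
        (\<Sum>k. emeasure (return borel (- real (Suc k) * ln q)) (F i))) =
      ennreal (- ln q) * (\<Sum>k. emeasure (return borel (- real (Suc k) * ln q)) (\<Union>i. F i))"
      by simp
  qed
qed

text \<open>Meant for open intervals \<open>I\<close>, since derivatives are two-sided.\<close>

definition strictly_completely_monotonic_on :: "real set \<Rightarrow> (real \<Rightarrow> real) \<Rightarrow> bool" where
  "strictly_completely_monotonic_on I f \<longleftrightarrow>
     (\<forall>n. \<forall>x\<in>I. (deriv ^^ n) f differentiable (at x)) \<and>
     (\<forall>n. \<forall>x\<in>I. (-1) ^ n * (deriv ^^ n) f x > 0)"

end

theory Submission
  imports Defs "HOL-Computational_Algebra.Polynomial"
begin

text \<open>
  Put \<open>L = - ln q > 0\<close> and \<open>u(x) = q\<^sup>x / (1 - q\<^sup>x)\<close>. Taking logarithms turns the product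
  defining \<open>\<Gamma>\<^bsub>p,q\<^esub>\<close> into a sum, and \<open>ln [y]\<^sub>q\<close> has derivative \<open>L u(y)\<close>, which gives the closed form
  \<open>\<psi>(x) = ln [p]\<^sub>q - L (u(x) + u(x + 1) + \<dots> + u(x + p))\<close> (\<open>psi_pq_eq\<close>).

  For the integral, the atom of \<open>\<gamma>\<^sub>q\<close> at \<open>t = j L\<close> turns \<open>exp (- t)\<close> into \<open>r = q\<^sup>j\<close>. The factor
  \<open>(1 - exp (- (p + 1) t)) / (1 - exp (- t))\<close> becomes the finite geometric sum
  \<open>1 + r + \<dots> + r\<^sup>p\<close>, and for each \<open>k \<le> p\<close> the powers \<open>q ^ (j (x + k))\<close> with \<open>j \<ge> 1\<close> form a
  geometric series with sum \<open>u(x + k)\<close> (\<open>psi_kernel_sums\<close>).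

  Monotonicity and complete monotonicity rest on the Riccati equation \<open>u' = - L u (1 + u)\<close>:
  differentiating a polynomial in \<open>u\<close> yields \<open>- L\<close> times another polynomial in \<open>u\<close>, and
  nonnegative coefficients stay nonnegative. Hence the \<open>n\<close>-th derivative of \<open>u\<close> is \<open>(- L)\<^sup>n\<close>
  times a polynomial in \<open>u\<close> that is positive at positive arguments
  (\<open>poly_riccati_poly_pos\<close>), and so every derivative of \<open>\<psi>\<close> has the required sign
  (\<open>qgeom_sum_deriv_sign\<close>).
\<close>

section \<open>The function \<open>q\<^sup>x / (1 - q\<^sup>x)\<close> and its derivatives\<close>

definition qgeom :: "real \<Rightarrow> real \<Rightarrow> real" where
  "qgeom q x = q powr x / (1 - q powr x)"

lemma powr_less_one_base:
  fixes q x :: real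
  assumes "0 < q" "q < 1" "0 < x"
  shows "q powr x < 1"
  using powr_less_mono2[of x q 1] assms by simp

lemma qgeom_pos:
  assumes "0 < q" "q < 1" "0 < x"
  shows "0 < qgeom q x"
  using powr_less_one_base[OF assms] assms by (simp add: qgeom_def)

text \<open>The right-hand side is a polynomial in \<^const>\<open>qgeom\<close> itself, so that all higher derivatives
  are computable without meeting a quotient again.\<close>

lemma has_real_derivative_qgeom:
  assumes "0 < q" "q < 1" "0 < x"
  shows "(qgeom q has_real_derivative ln q * (qgeom q x * (1 + qgeom q x))) (at x)"
proof -
  have lt: "q powr x < 1" by (rule powr_less_one_base[OF assms])
  have eq: "(q powr x * ln q * (1 - q powr x) - q powr x * (- (q powr x * ln q)))
              / ((1 - q powr x) * (1 - q powr x))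
            = ln q * (qgeom q x * (1 + qgeom q x))"
    using lt unfolding qgeom_def by (simp add: divide_simps) algebra
  have powr: "((\<lambda>y. q powr y) has_real_derivative q powr x * ln q) (at x)"
    using assms by (auto intro!: derivative_eq_intros)
  have one_minus: "((\<lambda>y. 1 - q powr y) has_real_derivative - (q powr x * ln q)) (at x)"
    using DERIV_diff[OF DERIV_const powr, of 1] by simp
  have "((\<lambda>y. q powr y / (1 - q powr y)) has_real_derivative
      ln q * (qgeom q x * (1 + qgeom q x))) (at x)"
    using DERIV_divide[OF powr one_minus] lt unfolding eq by simp
  then show ?thesis
    unfolding qgeom_def[abs_def] by simp
qed

text \<open>Repeated application of \<open>u (1 + u) d/du\<close> to \<open>u\<close>: the derivation that the Riccati equation
  for \<^const>\<open>qgeom\<close> induces on polynomials in \<open>u\<close>, stripped of the factor \<open>ln q\<close>.\<close>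

primrec riccati_poly :: "nat \<Rightarrow> real poly" where
  "riccati_poly 0 = [:0, 1:]"
| "riccati_poly (Suc n) = [:0, 1, 1:] * pderiv (riccati_poly n)"

lemma coeff_riccati_poly_nonneg: "0 \<le> coeff (riccati_poly n) i"
proof (induction n arbitrary: i)
  case 0
  then show ?case by (simp add: coeff_pCons split: nat.split)
next
  case (Suc n)
  have "0 \<le> coeff [:0, 1, 1 :: real:] j" for j
    by (simp add: coeff_pCons split: nat.split)
  with Suc show ?case
    unfolding riccati_poly.simps coeff_mult
    by (intro sum_nonneg mult_nonneg_nonneg) (auto simp: coeff_pderiv)
qed

lemma coeff_riccati_poly_one: "coeff (riccati_poly n) 1 = 1"
  by (induction n) (simp_all add: coeff_pderiv)

text \<open>Nonnegative coefficients alone would allow the zero polynomial; the linear coefficient, which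
  the derivation preserves, makes the inequality strict.\<close>

lemma poly_riccati_poly_pos:
  assumes "0 < u"
  shows "0 < poly (riccati_poly n) u"
proof -
  have "1 \<le> degree (riccati_poly n)"
    by (rule le_degree) (use coeff_riccati_poly_one[of n] in simp)
  then show ?thesis
    unfolding poly_altdef
    by (intro sum_pos2[of _ 1])
       (use assms coeff_riccati_poly_nonneg coeff_riccati_poly_one in \<open>auto simp del: One_nat_def\<close>)
qed

lemma has_real_derivative_poly_qgeom:
  assumes "0 < q" "q < 1" "0 < x"
  shows "((\<lambda>y. poly (riccati_poly n) (qgeom q y)) has_real_derivative
           ln q * poly (riccati_poly (Suc n)) (qgeom q x)) (at x)"
proof -
  have "((\<lambda>y. poly (riccati_poly n) (qgeom q y)) has_real_derivative
      poly (pderiv (riccati_poly n)) (qgeom q x) * (ln q * (qgeom q x * (1 + qgeom q x)))) (at x)"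
    by (rule DERIV_chain2[OF poly_DERIV has_real_derivative_qgeom[OF assms]])
  then show ?thesis
    by (simp add: algebra_simps)
qed

text \<open>For \<open>n = 0\<close> this is \<open>\<psi>\<^bsub>p,q\<^esub>\<close> without its constant \<open>ln [p]\<^sub>q\<close>; for \<open>n > 0\<close> it is the \<open>n\<close>-th
  derivative of \<open>\<psi>\<^bsub>p,q\<^esub>\<close>. Of the \<open>n + 1\<close> factors \<open>ln q\<close>, one stands in \<open>\<psi>\<^bsub>p,q\<^esub>\<close> and one comes from
  each differentiation.\<close>

definition qgeom_sum_deriv :: "nat \<Rightarrow> real \<Rightarrow> nat \<Rightarrow> real \<Rightarrow> real" where
  "qgeom_sum_deriv p q n x = ln q ^ Suc n * (\<Sum>k=0..p. poly (riccati_poly n) (qgeom q (x + real k)))"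

lemma has_real_derivative_qgeom_sum_deriv:
  assumes "0 < q" "q < 1" "0 < x"
  shows "(qgeom_sum_deriv p q n has_real_derivative qgeom_sum_deriv p q (Suc n) x) (at x)"
proof -
  have "((\<lambda>y. poly (riccati_poly n) (qgeom q (y + real k))) has_real_derivative
           ln q * poly (riccati_poly (Suc n)) (qgeom q (x + real k))) (at x)" for k
    using has_real_derivative_poly_qgeom[of q "x + real k" n] assms
    unfolding DERIV_shift by simp
  then have "((\<lambda>y. ln q ^ Suc n * (\<Sum>k=0..p. poly (riccati_poly n) (qgeom q (y + real k))))
      has_real_derivative
        ln q ^ Suc n * (\<Sum>k=0..p. ln q * poly (riccati_poly (Suc n)) (qgeom q (x + real k)))) (at x)"
    by (intro DERIV_cmult DERIV_sum)
  then show ?thesis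
    unfolding qgeom_sum_deriv_def[abs_def]
    by (simp add: sum_distrib_left[symmetric] mult_ac)
qed

lemma qgeom_sum_deriv_sign:
  assumes "0 < q" "q < 1" "0 < x"
  shows "0 < (-1) ^ Suc n * qgeom_sum_deriv p q n x"
proof -
  have "0 < (\<Sum>k=0..p. poly (riccati_poly n) (qgeom q (x + real k)))"
    using assms by (intro sum_pos poly_riccati_poly_pos qgeom_pos) auto
  moreover have "0 < (- ln q) ^ Suc n"
    using assms by (intro zero_less_power) simp
  ultimately have "0 < (- ln q) ^ Suc n * (\<Sum>k=0..p. poly (riccati_poly n) (qgeom q (x + real k)))"
    by (rule mult_pos_pos[rotated])
  then show ?thesis
    unfolding qgeom_sum_deriv_def power_minus[of "ln q"] by (simp only: mult.assoc)
qed

text \<open>\<^const>\<open>deriv\<close> at a point sees a function only near that point, so openness lets a formula that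
  is valid on \<open>S\<close> alone be differentiated again and again.\<close>

lemma funpow_deriv_eq_on_open:
  fixes f :: "real \<Rightarrow> real" and F :: "nat \<Rightarrow> real \<Rightarrow> real"
  assumes "open S"
    and "\<And>x. x \<in> S \<Longrightarrow> f x = F 0 x"
    and "\<And>n x. x \<in> S \<Longrightarrow> (F n has_real_derivative F (Suc n) x) (at x)"
  shows "x \<in> S \<Longrightarrow> (deriv ^^ n) f x = F n x"
    and "x \<in> S \<Longrightarrow> ((deriv ^^ n) f has_real_derivative F (Suc n) x) (at x)"
proof -
  have step: "((deriv ^^ n) f has_real_derivative F (Suc n) x) (at x)"
    if "\<forall>y\<in>S. (deriv ^^ n) f y = F n y" "x \<in> S" for n x
    by (rule has_field_derivative_transform_within_open[OF assms(3)[OF that(2)] assms(1) that(2)])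
       (use that in auto)
  have eq: "\<forall>y\<in>S. (deriv ^^ n) f y = F n y" for n
    by (induction n) (use assms(2) step in \<open>auto intro: DERIV_imp_deriv\<close>)
  show "x \<in> S \<Longrightarrow> (deriv ^^ n) f x = F n x"
    using eq by blast
  show "x \<in> S \<Longrightarrow> ((deriv ^^ n) f has_real_derivative F (Suc n) x) (at x)"
    using step eq by blast
qed

section \<open>The logarithmic derivative of the \<open>(p,q)\<close>-Gamma function\<close>

lemma q_number_pos:
  assumes "0 < q" "q < 1" "0 < x"
  shows "0 < q_number q x"
  using powr_less_one_base[OF assms] assms by (simp add: q_number_def)

lemma ln_Gamma_pq:
  assumes "0 < p" "0 < q" "q < 1" "0 < x"
  shows "ln (Gamma_pq p q x) = x * ln (q_number q (real p)) + ln (q_fact q p)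
           - (\<Sum>k=0..p. ln (q_number q (x + real k)))"
proof -
  have p: "0 < q_number q (real p)"
    using assms by (intro q_number_pos) auto
  have fact: "0 < q_fact q p"
    unfolding q_fact_def using assms by (intro prod_pos q_number_pos ballI) auto
  have factor: "0 < q_number q (x + real k)" for k
    using assms by (intro q_number_pos) auto
  then have prod: "0 < (\<Prod>k=0..p. q_number q (x + real k))"
    by (intro prod_pos) auto
  have "ln (\<Prod>k=0..p. q_number q (x + real k)) = (\<Sum>k=0..p. ln (q_number q (x + real k)))"
    using factor[THEN less_imp_neq, THEN not_sym] by (intro ln_prod) auto
  with p fact prod show ?thesis
    by (simp add: Gamma_pq_def ln_div ln_mult ln_powr factor[THEN less_imp_neq, THEN not_sym])
qed

lemma has_real_derivative_ln_q_number:
  assumes "0 < q" "q < 1" "0 < x"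
  shows "((\<lambda>y. ln (q_number q y)) has_real_derivative - (ln q * qgeom q x)) (at x)"
proof -
  have pos: "0 < q_number q x" by (rule q_number_pos[OF assms])
  have "(q_number q has_real_derivative - (q powr x * ln q) / (1 - q)) (at x)"
    unfolding q_number_def[abs_def] using assms by (auto intro!: derivative_eq_intros)
  then have "((\<lambda>y. ln (q_number q y)) has_real_derivative
      1 / q_number q x * (- (q powr x * ln q) / (1 - q))) (at x)"
    by (rule DERIV_chain2[where f = ln and g = "q_number q", OF DERIV_ln_divide[OF pos]])
  moreover have "1 / q_number q x * (- (q powr x * ln q) / (1 - q)) = - (ln q * qgeom q x)"
    using assms powr_less_one_base[OF assms] by (simp add: q_number_def qgeom_def)
  ultimately show ?thesis by simp
qed

lemma has_real_derivative_ln_Gamma_pq: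
  assumes "0 < p" "0 < q" "q < 1" "0 < x"
  shows "((\<lambda>y. ln (Gamma_pq p q y)) has_real_derivative
           ln (q_number q (real p)) + ln q * (\<Sum>k=0..p. qgeom q (x + real k))) (at x)"
proof -
  have "((\<lambda>y. ln (q_number q (y + real k))) has_real_derivative
           - (ln q * qgeom q (x + real k))) (at x)" for k
    using has_real_derivative_ln_q_number[of q "x + real k"] assms
    unfolding DERIV_shift by simp
  then have "((\<lambda>y. \<Sum>k=0..p. ln (q_number q (y + real k))) has_real_derivative
           (\<Sum>k=0..p. - (ln q * qgeom q (x + real k)))) (at x)"
    by (intro DERIV_sum)
  moreover have "((\<lambda>y. y * ln (q_number q (real p)) + ln (q_fact q p)) has_real_derivative
      ln (q_number q (real p))) (at x)"
    by (auto intro!: derivative_eq_intros)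
  ultimately have "((\<lambda>y. y * ln (q_number q (real p)) + ln (q_fact q p)
           - (\<Sum>k=0..p. ln (q_number q (y + real k)))) has_real_derivative
      ln (q_number q (real p)) - (\<Sum>k=0..p. - (ln q * qgeom q (x + real k)))) (at x)"
    by (intro DERIV_diff)
  then have "((\<lambda>y. y * ln (q_number q (real p)) + ln (q_fact q p)
           - (\<Sum>k=0..p. ln (q_number q (y + real k)))) has_real_derivative
      ln (q_number q (real p)) + ln q * (\<Sum>k=0..p. qgeom q (x + real k))) (at x)"
    by (simp add: sum_negf sum_distrib_left)
  then show ?thesis
    by (rule has_field_derivative_transform_within_open[of _ _ _ "{0<..}"])
       (use assms ln_Gamma_pq in auto)
qed

lemma psi_pq_eq:
  assumes "0 < p" "0 < q" "q < 1" "0 < x"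
  shows "psi_pq p q x = ln (q_number q (real p)) + ln q * (\<Sum>k=0..p. qgeom q (x + real k))"
  unfolding psi_pq_def by (rule DERIV_imp_deriv[OF has_real_derivative_ln_Gamma_pq[OF assms]])

lemma has_real_derivative_psi_pq:
  assumes "0 < p" "0 < q" "q < 1" "0 < x"
  shows "(psi_pq p q has_real_derivative qgeom_sum_deriv p q 1 x) (at x)"
proof -
  have "((\<lambda>y. ln (q_number q (real p)) + qgeom_sum_deriv p q 0 y) has_real_derivative
      qgeom_sum_deriv p q 1 x) (at x)"
    using DERIV_add[OF DERIV_const has_real_derivative_qgeom_sum_deriv[of q x p 0]] assms by simp
  then show ?thesis
    by (rule has_field_derivative_transform_within_open[of _ _ _ "{0<..}"])
       (use assms psi_pq_eq in \<open>auto simp: qgeom_sum_deriv_def\<close>)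
qed

lemma strict_mono_on_psi_pq:
  assumes "0 < p" "0 < q" "q < 1"
  shows "strict_mono_on {0<..} (psi_pq p q)"
proof (rule strict_mono_onI)
  fix x y :: real
  assume xy: "x \<in> {0<..}" "y \<in> {0<..}" "x < y"
  show "psi_pq p q x < psi_pq p q y"
  proof (rule DERIV_pos_imp_increasing[OF xy(3)])
    fix z assume "x \<le> z" "z \<le> y"
    with xy have "0 < z" by simp
    with has_real_derivative_psi_pq[OF assms] qgeom_sum_deriv_sign[OF assms(2,3), of z 1 p]
    show "\<exists>d. (psi_pq p q has_real_derivative d) (at z) \<and> 0 < d" by auto
  qed
qed

lemma strictly_completely_monotonic_deriv_psi_pq:
  assumes "0 < p" "0 < q" "q < 1"
  shows "strictly_completely_monotonic_on {0<..} (deriv (psi_pq p q))"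
proof -
  have start: "deriv (psi_pq p q) x = qgeom_sum_deriv p q (Suc 0) x" if "x \<in> {0<..}" for x
    using DERIV_imp_deriv[OF has_real_derivative_psi_pq[OF assms]] that by simp
  have step: "(qgeom_sum_deriv p q (Suc n) has_real_derivative
      qgeom_sum_deriv p q (Suc (Suc n)) x) (at x)" if "x \<in> {0<..}" for n x
    using has_real_derivative_qgeom_sum_deriv[OF assms(2,3)] that by simp
  note iterated = funpow_deriv_eq_on_open[OF open_greaterThan,
      where F = "\<lambda>n. qgeom_sum_deriv p q (Suc n)", OF start step]
  show ?thesis
    unfolding strictly_completely_monotonic_on_def
  proof (intro conjI allI ballI)
    fix n and x :: real assume x: "x \<in> {0<..}"
    show "(deriv ^^ n) (deriv (psi_pq p q)) differentiable (at x)"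
      using iterated(2)[OF _ _ x] by (auto simp: real_differentiable_def)
    show "(-1) ^ n * (deriv ^^ n) (deriv (psi_pq p q)) x > 0"
      using iterated(1)[OF _ _ x, of n] qgeom_sum_deriv_sign[OF assms(2,3), of x "Suc n" p] x
      by simp
  qed
qed

section \<open>Integration against \<open>\<gamma>\<^sub>q\<close>\<close>

text \<open>Realising \<open>\<gamma>\<^sub>q\<close> as an image of a multiple of counting measure reduces its integrals to series.\<close>

lemma gamma_q_eq_distr:
  "gamma_q q = distr (density (count_space UNIV) (\<lambda>_. ennreal (- ln q))) borel
     (\<lambda>k::nat. - real (Suc k) * ln q)"
proof (rule measure_eqI)
  fix A assume "A \<in> sets (gamma_q q)"
  then have A: "A \<in> sets borel" by simp
  have "emeasure (distr (density (count_space UNIV) (\<lambda>_. ennreal (- ln q))) borel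
      (\<lambda>k::nat. - real (Suc k) * ln q)) A =
    (\<Sum>k. ennreal (- ln q) * indicator ((\<lambda>k::nat. - real (Suc k) * ln q) -` A) k)"
    using A by (simp add: emeasure_distr emeasure_density nn_integral_count_space_nat)
  also have "\<dots> = emeasure (gamma_q q) A"
    using A by (simp add: emeasure_gamma_q indicator_def)
  finally show "emeasure (gamma_q q) A = emeasure (distr (density (count_space UNIV)
      (\<lambda>_. ennreal (- ln q))) borel (\<lambda>k::nat. - real (Suc k) * ln q)) A" ..
qed simp

text \<open>Nonnegativity at the atoms makes the convergence of the series absolute, which integrability
  demands.\<close>

lemma
  fixes f :: "real \<Rightarrow> real"
  assumes "0 < q" "q < 1" and [measurable]: "f \<in> borel_measurable borel"
    and nonneg: "\<And>k. 0 \<le> f (- real (Suc k) * ln q)"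
    and sums: "(\<lambda>k. f (- real (Suc k) * ln q)) sums s"
  shows integrable_gamma_q: "set_integrable (gamma_q q) {0<..} f"
    and integral_gamma_q: "(LINT t:{0<..}|gamma_q q. f t) = - ln q * s"
proof -
  let ?g = "\<lambda>k::nat. - real (Suc k) * ln q"
  have L: "0 \<le> - ln q" using assms by simp
  have atom_pos: "0 < ?g k" for k using assms by (simp add: mult_less_0_iff zero_less_mult_iff)
  have sums': "(\<lambda>k. - ln q * (indicator {0<..} (?g k) * f (?g k))) sums (- ln q * s)"
    using sums_mult[OF sums, of "- ln q"] atom_pos by simp
  have int: "integrable (count_space UNIV) (\<lambda>k. - ln q * (indicator {0<..} (?g k) * f (?g k)))"
    unfolding integrable_count_space_nat_iff
    using sums_summable[OF sums'] L nonneg by (simp add: abs_mult)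
  show "set_integrable (gamma_q q) {0<..} f"
    unfolding set_integrable_def gamma_q_eq_distr
    using int L by (simp add: integrable_distr_eq integrable_density)
  show "(LINT t:{0<..}|gamma_q q. f t) = - ln q * s"
  proof -
    have "(LINT t:{0<..}|gamma_q q. f t)
        = (LINT k|count_space UNIV. - ln q * (indicator {0<..} (?g k) * f (?g k)))"
      unfolding set_lebesgue_integral_def gamma_q_eq_distr
      using L by (simp add: integral_distr integral_density)
    also have "\<dots> = (\<Sum>k. - ln q * (indicator {0<..} (?g k) * f (?g k)))"
      by (rule integral_count_space_nat[OF int])
    also have "\<dots> = - ln q * s"
      by (rule sums_unique[OF sums', symmetric])
    finally show ?thesis .
  qed
qed

text \<open>Both parts come from rewriting the value at the \<open>j\<close>-th atom as a finite sum of powers, one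
  for each \<open>k \<le> p\<close>; the resulting \<open>p + 1\<close> geometric series are summed separately.\<close>

lemma
  fixes p :: nat and q x :: real
  assumes "0 < q" "q < 1" "0 < x"
  defines "f \<equiv> \<lambda>t. exp (- x * t) / (1 - exp (- t)) * (1 - exp (- (real p + 1) * t))"
  shows psi_kernel_nonneg: "0 \<le> f (- real (Suc j) * ln q)"
    and psi_kernel_sums: "(\<lambda>j. f (- real (Suc j) * ln q)) sums (\<Sum>k=0..p. qgeom q (x + real k))"
proof -
  have exp_atom: "exp (- y * (- real (Suc j) * ln q)) = (q powr y) ^ Suc j" for y j
    using assms by (simp add: powr_def exp_of_nat_mult[symmetric] algebra_simps del: power_Suc)
  have kernel: "f (- real (Suc j) * ln q) = (\<Sum>k=0..p. (q powr (x + real k)) ^ Suc j)" for j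
  proof -
    let ?r = "q ^ Suc j"
    have r: "?r < 1" using assms by (intro power_Suc_less_one) auto
    have e1: "exp (- (- real (Suc j) * ln q)) = ?r"
      using exp_atom[of 1 j] assms by simp
    have ep: "exp (- (real p + 1) * (- real (Suc j) * ln q)) = ?r ^ Suc p"
      using exp_atom[of "real p + 1" j] powr_realpow[of q "Suc p"] assms
      by (simp add: power_mult[symmetric] mult.commute add.commute del: power_Suc)
    have "f (- real (Suc j) * ln q) = (q powr x) ^ Suc j * ((1 - ?r ^ Suc p) / (1 - ?r))"
      unfolding f_def exp_atom[of x] e1 ep by simp
    also have "(1 - ?r ^ Suc p) / (1 - ?r) = (\<Sum>k=0..p. ?r ^ k)"
      using r by (simp add: sum_gp0 atLeast0AtMost del: power_Suc)
    also have "(q powr x) ^ Suc j * (\<Sum>k=0..p. ?r ^ k) = (\<Sum>k=0..p. (q powr (x + real k)) ^ Suc j)"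
      unfolding sum_distrib_left using assms
      by (intro sum.cong refl)
         (simp add: powr_add powr_realpow power_mult_distrib power_mult[symmetric] mult.commute
            del: power_Suc)
    finally show ?thesis .
  qed
  show "0 \<le> f (- real (Suc j) * ln q)"
    unfolding kernel by (intro sum_nonneg) simp
  have "(\<lambda>j. (q powr (x + real k)) ^ Suc j) sums qgeom q (x + real k)" for k
  proof -
    have "q powr (x + real k) < 1"
      using assms by (intro powr_less_one_base) auto
    then have "(\<lambda>j. q powr (x + real k) * (q powr (x + real k)) ^ j) sums
        (q powr (x + real k) * (1 / (1 - q powr (x + real k))))"
      by (intro sums_mult geometric_sums) simp
    then show ?thesis by (simp add: qgeom_def)
  qed
  then show "(\<lambda>j. f (- real (Suc j) * ln q)) sums (\<Sum>k=0..p. qgeom q (x + real k))"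
    unfolding kernel by (intro sums_sum)
qed


theorem lemma2p3:
  fixes p :: nat and q :: real
  assumes "p > 0" and "0 < q" and "q < 1"
  shows "(\<forall>x>0. (\<lambda>y. ln (Gamma_pq p q y)) differentiable (at x)) \<and>
    (\<forall>x>0. psi_pq p q x = ln (q_number q (real p))
        + ln q * (\<Sum>k=0..p. q powr (x + real k) / (1 - q powr (x + real k)))) \<and>
    (\<forall>x>0. set_integrable (gamma_q q) {0<..}
        (\<lambda>t. exp (- x * t) / (1 - exp (- t)) * (1 - exp (- (real p + 1) * t)))) \<and>
    (\<forall>x>0. psi_pq p q x = ln (q_number q (real p))
        - (LINT t:{0<..}|gamma_q q.
             exp (- x * t) / (1 - exp (- t)) * (1 - exp (- (real p + 1) * t)))) \<and>
    strict_mono_on {0<..} (psi_pq p q) \<and>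
    (\<forall>x>0. psi_pq p q differentiable (at x)) \<and>
    strictly_completely_monotonic_on {0<..} (deriv (psi_pq p q))"
proof -
  note pq = assms
  let ?f = "\<lambda>x t. exp (- x * t) / (1 - exp (- t)) * (1 - exp (- (real p + 1) * t))"
  have meas: "?f x \<in> borel_measurable borel" for x by measurable
  have integral: "set_integrable (gamma_q q) {0<..} (?f x)"
    "(LINT t:{0<..}|gamma_q q. ?f x t) = - ln q * (\<Sum>k=0..p. qgeom q (x + real k))"
    if "0 < x" for x
    using integrable_gamma_q[OF pq(2,3) meas psi_kernel_nonneg psi_kernel_sums]
      integral_gamma_q[OF pq(2,3) meas psi_kernel_nonneg psi_kernel_sums] pq that by blast+
  show ?thesis
  proof (intro conjI allI impI)
    fix x :: real assume x: "0 < x"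
    show "(\<lambda>y. ln (Gamma_pq p q y)) differentiable (at x)"
      using has_real_derivative_ln_Gamma_pq[OF pq x] by (auto simp: real_differentiable_def)
    show "psi_pq p q x = ln (q_number q (real p))
        + ln q * (\<Sum>k=0..p. q powr (x + real k) / (1 - q powr (x + real k)))"
      using psi_pq_eq[OF pq x] by (simp add: qgeom_def)
    show "set_integrable (gamma_q q) {0<..} (?f x)"
      by (rule integral(1)[OF x])
    show "psi_pq p q x = ln (q_number q (real p)) - (LINT t:{0<..}|gamma_q q. ?f x t)"
      using psi_pq_eq[OF pq x] unfolding integral(2)[OF x] by simp
    show "psi_pq p q differentiable (at x)"
      using has_real_derivative_psi_pq[OF pq x] by (auto simp: real_differentiable_def)
  qed (rule strict_mono_on_psi_pq[OF pq] strictly_completely_monotonic_deriv_psi_pq[OF pq])+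
qed

end
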